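(* Let $T$ be a ternary $\Gamma$-semiring and let $f:M\to N$ be a morphism in $\mathsf{SMod}_{T,\Gamma}$. The underlying relation of the kernel pair of $f$ is $$R_f:=\{(x,y)\in M\times M\mid f(x)=f(y)\},$$ and $R_f$ is a congruence on the semimodule $M$.
   Context: Fix a commutative monoid $(\Gamma,+,0_\Gamma)$. A ternary $\Gamma$-semiring is a commutative monoid $(T,+,0)$ with a map $T\times\Gamma\times T\times\Gamma\times T\to T$, $(a,\alpha,b,\beta,c)\mapsto a\alpha b\beta c$, that is additive in each of the five slots separately, satisfies ternary associativity $(a\alpha b\beta c)\gamma d\delta e=a\alpha(b\beta c\gamma d)\delta e=a\alpha b\beta(c\gamma d\delta e)$ for all $a,b,c,d,e\in T$, $\alpha,\beta,\gamma,\delta\in\Gamma$, and satisfies $a\alpha b\beta c=0$ whenever one of $a,b,c$ is $0$ or one of $\alpha,\beta$ is $0_\Gamma$. A ternary $\Gamma$-semimodule over $T$ is a commutative monoid $(M,+,0)$ with a map $T\times\Gamma\times M\times\Gamma\times T\to M$, $(a,\alpha,m,\beta,b)\mapsto a\alpha m\beta b$, that is additive in each of the five slots separately, satisfies $a\alpha m\beta b=0$ whenever $a=0$ or $m=0$ or $b=0$ or $\alpha=0_\Gamma$ or $\beta=0_\Gamma$, and satisfies $(a\alpha b\beta c)\gamma m\delta d=a\alpha(b\beta m\gamma c)\delta d$ for all $a,b,c,d\in T$, $m\in M$, $\alpha,\beta,\gamma,\delta\in\Gamma$. A morphism $f:M\to N$ is a monoid morphism with $f(a\alpha m\beta b)=a\alpha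 f(m)\beta b$ for all $a,b\in T$, $\alpha,\beta\in\Gamma$, $m\in M$. The resulting category is $\mathsf{SMod}_{T,\Gamma}$. A congruence on a semimodule $M$ is an equivalence relation $\equiv$ such that $x\equiv y$ implies $x+z\equiv y+z$ for all $z\in M$ and $a\alpha x\beta b\equiv a\alpha y\beta b$ for all $a,b\in T$, $\alpha,\beta\in\Gamma$. The kernel pair of $f:M\to N$ is the pullback $M\times_N M$ of $f$ along itself in $\mathsf{SMod}_{T,\Gamma}$ with its projections $p_1,p_2:M\times_N M\rightrightarrows M$; it is regarded as a subobject of $M\times M$ (cartesian product with componentwise operations) via $(p_1,p_2)$. *)

theory Defs
  imports "HOL-Algebra.Group"
begin

text \<open>
  Commutative monoids are those of HOL-Algebra, whose multiplicative operation and unit are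
  written additively here.
\<close>

abbreviation (input) madd :: "('a, 'b) monoid_scheme \<Rightarrow> 'a \<Rightarrow> 'a \<Rightarrow> 'a" (infixl \<open>\<boxplus>\<index>\<close> 65)
  where "madd G \<equiv> monoid.mult G"

abbreviation (input) mzero :: "('a, 'b) monoid_scheme \<Rightarrow> 'a" (\<open>\<^bold>0\<index>\<close>)
  where "mzero G \<equiv> monoid.one G"

record ('t, 'g) ternary_structure = "'t monoid" +
  tern :: "'t \<Rightarrow> 'g \<Rightarrow> 't \<Rightarrow> 'g \<Rightarrow> 't \<Rightarrow> 't"

locale ternary_gamma_semiring = Gam: comm_monoid \<Gamma> + T: comm_monoid T
  for \<Gamma> :: "'g monoid" and T :: "('t, 'g) ternary_structure" +
  assumes tern_closed:
    "\<lbrakk>a \<in> carrier T; \<alpha> \<in> carrier \<Gamma>; b \<in> carrier T; \<beta> \<in> carrier \<Gamma>; c \<in> carrier T\<rbrakk>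
      \<Longrightarrow> tern T a \<alpha> b \<beta> c \<in> carrier T"
  and tern_add_1:
    "\<lbrakk>a \<in> carrier T; a' \<in> carrier T; \<alpha> \<in> carrier \<Gamma>; b \<in> carrier T; \<beta> \<in> carrier \<Gamma>; c \<in> carrier T\<rbrakk>
      \<Longrightarrow> tern T (a \<boxplus>\<^bsub>T\<^esub> a') \<alpha> b \<beta> c = tern T a \<alpha> b \<beta> c \<boxplus>\<^bsub>T\<^esub> tern T a' \<alpha> b \<beta> c"
  and tern_add_2:
    "\<lbrakk>a \<in> carrier T; \<alpha> \<in> carrier \<Gamma>; \<alpha>' \<in> carrier \<Gamma>; b \<in> carrier T; \<beta> \<in> carrier \<Gamma>; c \<in> carrier T\<rbrakk>
      \<Longrightarrow> tern T a (\<alpha> \<boxplus>\<^bsub>\<Gamma>\<^esub> \<alpha>') b \<beta> c = tern T a \<alpha> b \<beta> c \<boxplus>\<^bsub>T\<^esub> tern T a \<alpha>' b \<beta> c"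
  and tern_add_3:
    "\<lbrakk>a \<in> carrier T; \<alpha> \<in> carrier \<Gamma>; b \<in> carrier T; b' \<in> carrier T; \<beta> \<in> carrier \<Gamma>; c \<in> carrier T\<rbrakk>
      \<Longrightarrow> tern T a \<alpha> (b \<boxplus>\<^bsub>T\<^esub> b') \<beta> c = tern T a \<alpha> b \<beta> c \<boxplus>\<^bsub>T\<^esub> tern T a \<alpha> b' \<beta> c"
  and tern_add_4:
    "\<lbrakk>a \<in> carrier T; \<alpha> \<in> carrier \<Gamma>; b \<in> carrier T; \<beta> \<in> carrier \<Gamma>; \<beta>' \<in> carrier \<Gamma>; c \<in> carrier T\<rbrakk>
      \<Longrightarrow> tern T a \<alpha> b (\<beta> \<boxplus>\<^bsub>\<Gamma>\<^esub> \<beta>') c = tern T a \<alpha> b \<beta> c \<boxplus>\<^bsub>T\<^esub> tern T a \<alpha> b \<beta>' c"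
  and tern_add_5:
    "\<lbrakk>a \<in> carrier T; \<alpha> \<in> carrier \<Gamma>; b \<in> carrier T; \<beta> \<in> carrier \<Gamma>; c \<in> carrier T; c' \<in> carrier T\<rbrakk>
      \<Longrightarrow> tern T a \<alpha> b \<beta> (c \<boxplus>\<^bsub>T\<^esub> c') = tern T a \<alpha> b \<beta> c \<boxplus>\<^bsub>T\<^esub> tern T a \<alpha> b \<beta> c'"
  and tern_assoc_left:
    "\<lbrakk>a \<in> carrier T; b \<in> carrier T; c \<in> carrier T; d \<in> carrier T; e \<in> carrier T;
      \<alpha> \<in> carrier \<Gamma>; \<beta> \<in> carrier \<Gamma>; \<gamma> \<in> carrier \<Gamma>; \<delta> \<in> carrier \<Gamma>\<rbrakk>
      \<Longrightarrow> tern T (tern T a \<alpha> b \<beta> c) \<gamma> d \<delta> e = tern T a \<alpha> (tern T b \<beta> c \<gamma> d) \<delta> e"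
  and tern_assoc_right:
    "\<lbrakk>a \<in> carrier T; b \<in> carrier T; c \<in> carrier T; d \<in> carrier T; e \<in> carrier T;
      \<alpha> \<in> carrier \<Gamma>; \<beta> \<in> carrier \<Gamma>; \<gamma> \<in> carrier \<Gamma>; \<delta> \<in> carrier \<Gamma>\<rbrakk>
      \<Longrightarrow> tern T a \<alpha> (tern T b \<beta> c \<gamma> d) \<delta> e = tern T a \<alpha> b \<beta> (tern T c \<gamma> d \<delta> e)"
  and tern_zero:
    "\<lbrakk>a \<in> carrier T; \<alpha> \<in> carrier \<Gamma>; b \<in> carrier T; \<beta> \<in> carrier \<Gamma>; c \<in> carrier T;
      a = \<^bold>0\<^bsub>T\<^esub> \<or> b = \<^bold>0\<^bsub>T\<^esub> \<or> c = \<^bold>0\<^bsub>T\<^esub> \<or> \<alpha> = \<^bold>0\<^bsub>\<Gamma>\<^esub> \<or> \<beta> = \<^bold>0\<^bsub>\<Gamma>\<^esub>\<rbrakk>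
      \<Longrightarrow> tern T a \<alpha> b \<beta> c = \<^bold>0\<^bsub>T\<^esub>"

record ('t, 'g, 'm) semimodule_structure = "'m monoid" +
  act :: "'t \<Rightarrow> 'g \<Rightarrow> 'm \<Rightarrow> 'g \<Rightarrow> 't \<Rightarrow> 'm"

locale ternary_gamma_semimodule = ternary_gamma_semiring \<Gamma> T + M: comm_monoid M
  for \<Gamma> :: "'g monoid" and T :: "('t, 'g) ternary_structure"
  and M :: "('t, 'g, 'm) semimodule_structure" +
  assumes act_closed:
    "\<lbrakk>a \<in> carrier T; \<alpha> \<in> carrier \<Gamma>; m \<in> carrier M; \<beta> \<in> carrier \<Gamma>; b \<in> carrier T\<rbrakk>
      \<Longrightarrow> act M a \<alpha> m \<beta> b \<in> carrier M"
  and act_add_1: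
    "\<lbrakk>a \<in> carrier T; a' \<in> carrier T; \<alpha> \<in> carrier \<Gamma>; m \<in> carrier M; \<beta> \<in> carrier \<Gamma>; b \<in> carrier T\<rbrakk>
      \<Longrightarrow> act M (a \<boxplus>\<^bsub>T\<^esub> a') \<alpha> m \<beta> b = act M a \<alpha> m \<beta> b \<boxplus>\<^bsub>M\<^esub> act M a' \<alpha> m \<beta> b"
  and act_add_2:
    "\<lbrakk>a \<in> carrier T; \<alpha> \<in> carrier \<Gamma>; \<alpha>' \<in> carrier \<Gamma>; m \<in> carrier M; \<beta> \<in> carrier \<Gamma>; b \<in> carrier T\<rbrakk>
      \<Longrightarrow> act M a (\<alpha> \<boxplus>\<^bsub>\<Gamma>\<^esub> \<alpha>') m \<beta> b = act M a \<alpha> m \<beta> b \<boxplus>\<^bsub>M\<^esub> act M a \<alpha>' m \<beta> b"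
  and act_add_3:
    "\<lbrakk>a \<in> carrier T; \<alpha> \<in> carrier \<Gamma>; m \<in> carrier M; m' \<in> carrier M; \<beta> \<in> carrier \<Gamma>; b \<in> carrier T\<rbrakk>
      \<Longrightarrow> act M a \<alpha> (m \<boxplus>\<^bsub>M\<^esub> m') \<beta> b = act M a \<alpha> m \<beta> b \<boxplus>\<^bsub>M\<^esub> act M a \<alpha> m' \<beta> b"
  and act_add_4:
    "\<lbrakk>a \<in> carrier T; \<alpha> \<in> carrier \<Gamma>; m \<in> carrier M; \<beta> \<in> carrier \<Gamma>; \<beta>' \<in> carrier \<Gamma>; b \<in> carrier T\<rbrakk>
      \<Longrightarrow> act M a \<alpha> m (\<beta> \<boxplus>\<^bsub>\<Gamma>\<^esub> \<beta>') b = act M a \<alpha> m \<beta> b \<boxplus>\<^bsub>M\<^esub> act M a \<alpha> m \<beta>' b"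
  and act_add_5:
    "\<lbrakk>a \<in> carrier T; \<alpha> \<in> carrier \<Gamma>; m \<in> carrier M; \<beta> \<in> carrier \<Gamma>; b \<in> carrier T; b' \<in> carrier T\<rbrakk>
      \<Longrightarrow> act M a \<alpha> m \<beta> (b \<boxplus>\<^bsub>T\<^esub> b') = act M a \<alpha> m \<beta> b \<boxplus>\<^bsub>M\<^esub> act M a \<alpha> m \<beta> b'"
  and act_zero:
    "\<lbrakk>a \<in> carrier T; \<alpha> \<in> carrier \<Gamma>; m \<in> carrier M; \<beta> \<in> carrier \<Gamma>; b \<in> carrier T;
      a = \<^bold>0\<^bsub>T\<^esub> \<or> m = \<^bold>0\<^bsub>M\<^esub> \<or> b = \<^bold>0\<^bsub>T\<^esub> \<or> \<alpha> = \<^bold>0\<^bsub>\<Gamma>\<^esub> \<or> \<beta> = \<^bold>0\<^bsub>\<Gamma>\<^esub>\<rbrakk>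
      \<Longrightarrow> act M a \<alpha> m \<beta> b = \<^bold>0\<^bsub>M\<^esub>"
  and act_assoc:
    "\<lbrakk>a \<in> carrier T; b \<in> carrier T; c \<in> carrier T; d \<in> carrier T; m \<in> carrier M;
      \<alpha> \<in> carrier \<Gamma>; \<beta> \<in> carrier \<Gamma>; \<gamma> \<in> carrier \<Gamma>; \<delta> \<in> carrier \<Gamma>\<rbrakk>
      \<Longrightarrow> act M (tern T a \<alpha> b \<beta> c) \<gamma> m \<delta> d = act M a \<alpha> (act M b \<beta> m \<gamma> c) \<delta> d"

text \<open>
  Morphisms are arbitrary HOL functions whose values outside the carrier are irrelevant, so two
  of them are the same morphism when they agree on the carrier of the source.
\<close>

definition smod_hom :: "'g monoid \<Rightarrow> ('t, 'g) ternary_structure \<Rightarrow>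
    ('t, 'g, 'm) semimodule_structure \<Rightarrow> ('t, 'g, 'n) semimodule_structure \<Rightarrow> ('m \<Rightarrow> 'n) set"
  where "smod_hom \<Gamma> T M N = {f. f \<in> hom M N \<and> f \<^bold>0\<^bsub>M\<^esub> = \<^bold>0\<^bsub>N\<^esub> \<and>
    (\<forall>a \<in> carrier T. \<forall>\<alpha> \<in> carrier \<Gamma>. \<forall>m \<in> carrier M. \<forall>\<beta> \<in> carrier \<Gamma>. \<forall>b \<in> carrier T.
      f (act M a \<alpha> m \<beta> b) = act N a \<alpha> (f m) \<beta> b)}"

definition smod_prod :: "('t, 'g, 'm) semimodule_structure \<Rightarrow> ('t, 'g, 'n) semimodule_structure \<Rightarrow>
    ('t, 'g, 'm \<times> 'n) semimodule_structure"
  where "smod_prod M N =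
    \<lparr>carrier = carrier (M \<times>\<times> N), monoid.mult = madd (M \<times>\<times> N), one = mzero (M \<times>\<times> N),
     act = (\<lambda>a \<alpha> (x, y) \<beta> b. (act M a \<alpha> x \<beta> b, act N a \<alpha> y \<beta> b))\<rparr>"

text \<open>
  \<open>is_smod_pullback TYPE('q) \<Gamma> T P p1 p2 M N L f g\<close>: the square with projections
  \<open>p1 : P \<rightarrow> M\<close>, \<open>p2 : P \<rightarrow> N\<close> over \<open>f : M \<rightarrow> L\<close>, \<open>g : N \<rightarrow> L\<close> commutes and has the universal property
  of a pullback with respect to all test semimodules whose elements are taken from the type
  \<open>'q\<close>. HOL cannot quantify over types inside a formula, so a pullback in the full category is
  this predicate for every \<open>'q\<close>.
\<close>

definition is_smod_pullback :: "'q itself \<Rightarrow> 'g monoid \<Rightarrow> ('t, 'g) ternary_structure \<Rightarrow>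
    ('t, 'g, 'p) semimodule_structure \<Rightarrow> ('p \<Rightarrow> 'm) \<Rightarrow> ('p \<Rightarrow> 'n) \<Rightarrow>
    ('t, 'g, 'm) semimodule_structure \<Rightarrow> ('t, 'g, 'n) semimodule_structure \<Rightarrow>
    ('t, 'g, 'l) semimodule_structure \<Rightarrow> ('m \<Rightarrow> 'l) \<Rightarrow> ('n \<Rightarrow> 'l) \<Rightarrow> bool"
  where "is_smod_pullback _ \<Gamma> T P p1 p2 M N L f g \<longleftrightarrow>
    ternary_gamma_semimodule \<Gamma> T P \<and>
    p1 \<in> smod_hom \<Gamma> T P M \<and> p2 \<in> smod_hom \<Gamma> T P N \<and>
    (\<forall>z \<in> carrier P. f (p1 z) = g (p2 z)) \<and>
    (\<forall>(Q :: ('t, 'g, 'q) semimodule_structure) q1 q2.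
      ternary_gamma_semimodule \<Gamma> T Q \<and>
      q1 \<in> smod_hom \<Gamma> T Q M \<and> q2 \<in> smod_hom \<Gamma> T Q N \<and>
      (\<forall>z \<in> carrier Q. f (q1 z) = g (q2 z)) \<longrightarrow>
      (\<exists>h \<in> smod_hom \<Gamma> T Q P.
        (\<forall>z \<in> carrier Q. p1 (h z) = q1 z \<and> p2 (h z) = q2 z) \<and>
        (\<forall>h' \<in> smod_hom \<Gamma> T Q P.
          (\<forall>z \<in> carrier Q. p1 (h' z) = q1 z \<and> p2 (h' z) = q2 z) \<longrightarrow>
          (\<forall>z \<in> carrier Q. h' z = h z))))"

definition is_kernel_pair :: "'q itself \<Rightarrow> 'g monoid \<Rightarrow> ('t, 'g) ternary_structure \<Rightarrow>
    ('t, 'g, 'p) semimodule_structure \<Rightarrow> ('p \<Rightarrow> 'm) \<Rightarrow> ('p \<Rightarrow> 'm) \<Rightarrow>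
    ('t, 'g, 'm) semimodule_structure \<Rightarrow> ('t, 'g, 'n) semimodule_structure \<Rightarrow> ('m \<Rightarrow> 'n) \<Rightarrow> bool"
  where "is_kernel_pair q \<Gamma> T P p1 p2 M N f \<longleftrightarrow> is_smod_pullback q \<Gamma> T P p1 p2 M M N f f"

definition underlying_rel :: "('t, 'g, 'p) semimodule_structure \<Rightarrow> ('p \<Rightarrow> 'm) \<Rightarrow> ('p \<Rightarrow> 'm) \<Rightarrow>
    ('m \<times> 'm) set"
  where "underlying_rel P p1 p2 = (\<lambda>z. (p1 z, p2 z)) ` carrier P"

definition kernel_rel :: "('t, 'g, 'm) semimodule_structure \<Rightarrow> ('m \<Rightarrow> 'n) \<Rightarrow> ('m \<times> 'm) set"
  where "kernel_rel M f = {(x, y) \<in> carrier M \<times> carrier M. f x = f y}"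

definition smod_congruence :: "'g monoid \<Rightarrow> ('t, 'g) ternary_structure \<Rightarrow>
    ('t, 'g, 'm) semimodule_structure \<Rightarrow> ('m \<times> 'm) set \<Rightarrow> bool"
  where "smod_congruence \<Gamma> T M R \<longleftrightarrow> equiv (carrier M) R \<and>
    (\<forall>(x, y) \<in> R. \<forall>z \<in> carrier M. (x \<boxplus>\<^bsub>M\<^esub> z, y \<boxplus>\<^bsub>M\<^esub> z) \<in> R) \<and>
    (\<forall>(x, y) \<in> R. \<forall>a \<in> carrier T. \<forall>\<alpha> \<in> carrier \<Gamma>. \<forall>\<beta> \<in> carrier \<Gamma>. \<forall>b \<in> carrier T.
      (act M a \<alpha> x \<beta> b, act M a \<alpha> y \<beta> b) \<in> R)"

end

theory Submission
  imports Defs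
begin

text \<open>
  The fibre product of \<open>f\<close> and \<open>g\<close>, with componentwise operations, is a pullback. If \<open>P\<close> is any
  pullback, the universal property gives a section \<open>s\<close> of \<open>p = (p1, p2)\<close> from the fibre product to \<open>P\<close>,
  so \<open>p\<close> is onto the fibre product; both \<open>s \<circ> p\<close> and the identity of \<open>P\<close> are lifts of \<open>p\<close>, so they
  agree and \<open>p\<close> is injective. Testing against \<open>P\<close> itself instead of the kernel of \<open>p\<close> keeps the
  argument within the element types of the fibre product and of \<open>P\<close>.
\<close>

definition fibre_rel :: "('m, 'c) monoid_scheme \<Rightarrow> ('n, 'd) monoid_scheme \<Rightarrow>
    ('m \<Rightarrow> 'l) \<Rightarrow> ('n \<Rightarrow> 'l) \<Rightarrow> ('m \<times> 'n) set"
  where "fibre_rel M N f g = {(x, y) \<in> carrier M \<times> carrier N. f x = g y}"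

text \<open>Only the carrier of the direct product changes, so \<open>smod_prod_simps\<close> still
  computes all operations. Being an abbreviation, it coincides with the record update in the theorem
  once \<open>kernel_rel\<close> is rewritten.\<close>

abbreviation fibre_prod :: "('t, 'g, 'm) semimodule_structure \<Rightarrow> ('t, 'g, 'n) semimodule_structure \<Rightarrow>
    ('m \<Rightarrow> 'l) \<Rightarrow> ('n \<Rightarrow> 'l) \<Rightarrow> ('t, 'g, 'm \<times> 'n) semimodule_structure"
  where "fibre_prod M N f g \<equiv> (smod_prod M N)\<lparr>carrier := fibre_rel M N f g\<rparr>"

text \<open>Reduces kernel pairs to pullbacks of a general cospan, the case where both legs are
  \<open>f\<close>.\<close>

lemma kernel_rel_eq_fibre_rel: "kernel_rel M f = fibre_rel M M f f"
  by (simp add: kernel_rel_def fibre_rel_def)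

lemma smod_prod_simps [simp]:
  "carrier (smod_prod M N) = carrier M \<times> carrier N"
  "monoid.mult (smod_prod M N) = (\<lambda>(x, y) (x', y'). (x \<boxplus>\<^bsub>M\<^esub> x', y \<boxplus>\<^bsub>N\<^esub> y'))"
  "monoid.one (smod_prod M N) = (\<^bold>0\<^bsub>M\<^esub>, \<^bold>0\<^bsub>N\<^esub>)"
  "act (smod_prod M N) a \<alpha> (x, y) \<beta> b = (act M a \<alpha> x \<beta> b, act N a \<alpha> y \<beta> b)"
  by (simp_all add: smod_prod_def DirProd_def)

lemma smod_homI:
  assumes "\<And>x. x \<in> carrier M \<Longrightarrow> f x \<in> carrier N"
    and "\<And>x y. \<lbrakk>x \<in> carrier M; y \<in> carrier M\<rbrakk> \<Longrightarrow> f (x \<boxplus>\<^bsub>M\<^esub> y) = f x \<boxplus>\<^bsub>N\<^esub> f y"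
    and "f \<^bold>0\<^bsub>M\<^esub> = \<^bold>0\<^bsub>N\<^esub>"
    and "\<And>a \<alpha> m \<beta> b. \<lbrakk>a \<in> carrier T; \<alpha> \<in> carrier \<Gamma>; m \<in> carrier M; \<beta> \<in> carrier \<Gamma>; b \<in> carrier T\<rbrakk>
      \<Longrightarrow> f (act M a \<alpha> m \<beta> b) = act N a \<alpha> (f m) \<beta> b"
  shows "f \<in> smod_hom \<Gamma> T M N"
  using assms by (simp add: smod_hom_def hom_def)

lemma smod_homD:
  assumes "f \<in> smod_hom \<Gamma> T M N"
  shows smod_hom_closed: "x \<in> carrier M \<Longrightarrow> f x \<in> carrier N"
    and smod_hom_add: "\<lbrakk>x \<in> carrier M; y \<in> carrier M\<rbrakk> \<Longrightarrow> f (x \<boxplus>\<^bsub>M\<^esub> y) = f x \<boxplus>\<^bsub>N\<^esub> f y"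
    and smod_hom_zero: "f \<^bold>0\<^bsub>M\<^esub> = \<^bold>0\<^bsub>N\<^esub>"
    and smod_hom_act: "\<lbrakk>a \<in> carrier T; \<alpha> \<in> carrier \<Gamma>; x \<in> carrier M; \<beta> \<in> carrier \<Gamma>; b \<in> carrier T\<rbrakk>
      \<Longrightarrow> f (act M a \<alpha> x \<beta> b) = act N a \<alpha> (f x) \<beta> b"
  using assms by (auto simp: smod_hom_def hom_def)

lemma smod_hom_id: "id \<in> smod_hom \<Gamma> T M M"
  by (rule smod_homI) auto

lemma smod_hom_comp:
  assumes "f \<in> smod_hom \<Gamma> T M N" and "g \<in> smod_hom \<Gamma> T N L"
  shows "g \<circ> f \<in> smod_hom \<Gamma> T M L"
  by (rule smod_homI) (simp_all add: smod_homD[OF assms(1)] smod_homD[OF assms(2)])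

lemma smod_hom_pair:
  assumes "p \<in> smod_hom \<Gamma> T P M" and "q \<in> smod_hom \<Gamma> T P N"
  shows "(\<lambda>z. (p z, q z)) \<in> smod_hom \<Gamma> T P (smod_prod M N)"
  by (rule smod_homI) (simp_all add: smod_homD[OF assms(1)] smod_homD[OF assms(2)])

text \<open>This is the mediating morphism into the fibre product. Commutation of the square is what
  places its values in the smaller carrier.\<close>

lemma smod_hom_pair_fibre_prod:
  assumes "p \<in> smod_hom \<Gamma> T P M" and "q \<in> smod_hom \<Gamma> T P N"
    and "\<And>z. z \<in> carrier P \<Longrightarrow> f (p z) = g (q z)"
  shows "(\<lambda>z. (p z, q z)) \<in> smod_hom \<Gamma> T P (fibre_prod M N f g)"
  by (rule smod_homI)
    (simp_all add: fibre_rel_def assms(3) smod_homD[OF assms(1)] smod_homD[OF assms(2)])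

lemma smod_hom_fst_fibre_prod: "fst \<in> smod_hom \<Gamma> T (fibre_prod M N f g) M"
  and smod_hom_snd_fibre_prod: "snd \<in> smod_hom \<Gamma> T (fibre_prod M N f g) N"
  by (rule smod_homI; auto simp: fibre_rel_def)+

text \<open>Because \<open>f\<close> and \<open>g\<close> preserve sum, zero and action, the fibre
  product is closed under the operations of the direct product; the axioms then hold
  componentwise.\<close>

lemma ternary_gamma_semimodule_fibre_prod:
  assumes "ternary_gamma_semimodule \<Gamma> T M" and "ternary_gamma_semimodule \<Gamma> T N"
    and f: "f \<in> smod_hom \<Gamma> T M L" and g: "g \<in> smod_hom \<Gamma> T N L"
  shows "ternary_gamma_semimodule \<Gamma> T (fibre_prod M N f g)"
proof -
  interpret M: ternary_gamma_semimodule \<Gamma> T M by fact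
  interpret N: ternary_gamma_semimodule \<Gamma> T N by fact
  note hom = smod_homD[OF f] smod_homD[OF g]
  note closed = M.act_closed N.act_closed
  have "comm_monoid (fibre_prod M N f g)"
    by (rule comm_monoidI) (auto simp: fibre_rel_def hom M.M.m_ac N.M.m_ac)
  moreover have "ternary_gamma_semimodule_axioms \<Gamma> T (fibre_prod M N f g)"
  proof (unfold_locales, goal_cases)
    case 1 then show ?case by (auto simp: fibre_rel_def hom closed)
  next
    case 2 then show ?case by (auto simp: M.act_add_1 N.act_add_1 fibre_rel_def)
  next
    case 3 then show ?case by (auto simp: M.act_add_2 N.act_add_2 fibre_rel_def)
  next
    case 4 then show ?case by (auto simp: M.act_add_3 N.act_add_3 fibre_rel_def)
  next
    case 5 then show ?case by (auto simp: M.act_add_4 N.act_add_4 fibre_rel_def)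
  next
    case 6 then show ?case by (auto simp: M.act_add_5 N.act_add_5 fibre_rel_def)
  next
    case (7 a \<alpha> m \<beta> b)
    then show ?case
      \<comment> \<open>If \<open>m\<close> is the zero pair, both components vanish; any other
        vanishing argument is shared by the two actions. The instances at \<open>fst m\<close> and
        \<open>snd m\<close> thus cover every disjunct.\<close>
      using M.act_zero[of a \<alpha> "fst m" \<beta> b] N.act_zero[of a \<alpha> "snd m" \<beta> b]
      by (cases m) (auto simp: fibre_rel_def)
  next
    case 8 then show ?case by (auto simp: M.act_assoc N.act_assoc fibre_rel_def)
  qed
  ultimately show ?thesis
    by (intro ternary_gamma_semimodule.intro M.ternary_gamma_semiring_axioms)
qed

text \<open>Pairing gives existence over any test type, and uniqueness holds because a pair is
  determined by its components.\<close>

lemma is_smod_pullback_fibre_prod: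
  fixes M :: "('t, 'g, 'm) semimodule_structure"
  assumes "ternary_gamma_semimodule \<Gamma> T M" and "ternary_gamma_semimodule \<Gamma> T N"
    and "f \<in> smod_hom \<Gamma> T M L" and "g \<in> smod_hom \<Gamma> T N L"
  shows "is_smod_pullback TYPE('q) \<Gamma> T (fibre_prod M N f g) fst snd M N L f g"
  unfolding is_smod_pullback_def
proof (intro conjI allI impI)
  fix Q :: "('t, 'g, 'q) semimodule_structure" and q1 q2
  assume "ternary_gamma_semimodule \<Gamma> T Q \<and> q1 \<in> smod_hom \<Gamma> T Q M \<and> q2 \<in> smod_hom \<Gamma> T Q N \<and>
    (\<forall>z \<in> carrier Q. f (q1 z) = g (q2 z))"
  then have "(\<lambda>z. (q1 z, q2 z)) \<in> smod_hom \<Gamma> T Q (fibre_prod M N f g)"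
    by (blast intro: smod_hom_pair_fibre_prod)
  then show "\<exists>h \<in> smod_hom \<Gamma> T Q (fibre_prod M N f g).
      (\<forall>z \<in> carrier Q. fst (h z) = q1 z \<and> snd (h z) = q2 z) \<and>
      (\<forall>h' \<in> smod_hom \<Gamma> T Q (fibre_prod M N f g).
        (\<forall>z \<in> carrier Q. fst (h' z) = q1 z \<and> snd (h' z) = q2 z) \<longrightarrow>
        (\<forall>z \<in> carrier Q. h' z = h z))"
    by (rule bexI[rotated]) (auto simp: prod_eq_iff)
qed (simp_all add: ternary_gamma_semimodule_fibre_prod[OF assms]
    smod_hom_fst_fibre_prod smod_hom_snd_fibre_prod, auto simp: fibre_rel_def)

lemma is_smod_pullbackD:
  assumes "is_smod_pullback q \<Gamma> T P p1 p2 M N L f g"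
  shows smod_pullback_semimodule: "ternary_gamma_semimodule \<Gamma> T P"
    and smod_pullback_hom_1: "p1 \<in> smod_hom \<Gamma> T P M"
    and smod_pullback_hom_2: "p2 \<in> smod_hom \<Gamma> T P N"
    and smod_pullback_commutes: "z \<in> carrier P \<Longrightarrow> f (p1 z) = g (p2 z)"
  using assms by (simp_all add: is_smod_pullback_def)

lemma smod_pullback_universal:
  fixes Q :: "('t, 'g, 'q) semimodule_structure"
  assumes "is_smod_pullback TYPE('q) \<Gamma> T P p1 p2 M N L f g"
    and "ternary_gamma_semimodule \<Gamma> T Q"
    and "q1 \<in> smod_hom \<Gamma> T Q M" and "q2 \<in> smod_hom \<Gamma> T Q N"
    and "\<forall>z \<in> carrier Q. f (q1 z) = g (q2 z)"
  obtains h where "h \<in> smod_hom \<Gamma> T Q P"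
    and "\<forall>z \<in> carrier Q. p1 (h z) = q1 z \<and> p2 (h z) = q2 z"
    and "\<forall>h' \<in> smod_hom \<Gamma> T Q P. (\<forall>z \<in> carrier Q. p1 (h' z) = q1 z \<and> p2 (h' z) = q2 z) \<longrightarrow>
      (\<forall>z \<in> carrier Q. h' z = h z)"
proof -
  have "\<exists>h \<in> smod_hom \<Gamma> T Q P. (\<forall>z \<in> carrier Q. p1 (h z) = q1 z \<and> p2 (h z) = q2 z) \<and>
      (\<forall>h' \<in> smod_hom \<Gamma> T Q P. (\<forall>z \<in> carrier Q. p1 (h' z) = q1 z \<and> p2 (h' z) = q2 z) \<longrightarrow>
        (\<forall>z \<in> carrier Q. h' z = h z))"
    using assms(1)[unfolded is_smod_pullback_def, THEN conjunct2, THEN conjunct2,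
        THEN conjunct2, THEN conjunct2] assms(2-5) by simp
  then show thesis by (elim bexE conjE) (rule that)
qed

text \<open>The projections of a pullback are jointly monic: \<open>h\<close> and \<open>h'\<close>
  are both lifts of the cone formed by \<open>p1 \<circ> h'\<close> and
  \<open>p2 \<circ> h'\<close>, hence both agree with the mediating morphism
  \<open>k\<close>.\<close>

lemma smod_pullback_unique:
  fixes Q :: "('t, 'g, 'q) semimodule_structure"
  assumes pb: "is_smod_pullback TYPE('q) \<Gamma> T P p1 p2 M N L f g"
    and Q: "ternary_gamma_semimodule \<Gamma> T Q"
    and h: "h \<in> smod_hom \<Gamma> T Q P" and h': "h' \<in> smod_hom \<Gamma> T Q P"
    and eq: "\<And>z. z \<in> carrier Q \<Longrightarrow> p1 (h z) = p1 (h' z)"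
      "\<And>z. z \<in> carrier Q \<Longrightarrow> p2 (h z) = p2 (h' z)"
    and z: "z \<in> carrier Q"
  shows "h z = h' z"
proof -
  have "p1 \<circ> h' \<in> smod_hom \<Gamma> T Q M" "p2 \<circ> h' \<in> smod_hom \<Gamma> T Q N"
    using h' smod_hom_comp smod_pullback_hom_1[OF pb] smod_pullback_hom_2[OF pb] by blast+
  moreover have "\<forall>z \<in> carrier Q. f ((p1 \<circ> h') z) = g ((p2 \<circ> h') z)"
    using smod_pullback_commutes[OF pb] smod_hom_closed[OF h'] by simp
  ultimately obtain k where k: "\<forall>l \<in> smod_hom \<Gamma> T Q P.
      (\<forall>z \<in> carrier Q. p1 (l z) = (p1 \<circ> h') z \<and> p2 (l z) = (p2 \<circ> h') z) \<longrightarrow>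
      (\<forall>z \<in> carrier Q. l z = k z)"
    by (rule smod_pullback_universal[OF pb Q])
  have "\<forall>z \<in> carrier Q. h z = k z"
    using k[THEN bspec, OF h] eq by simp
  moreover have "\<forall>z \<in> carrier Q. h' z = k z"
    using k[THEN bspec, OF h'] by simp
  ultimately show ?thesis using z by simp
qed

text \<open>The two hypotheses differ in the test type: \<open>pb_fibre\<close> yields the section
  \<open>s\<close>, and \<open>pb_self\<close> yields joint monicity of the projections on
  \<open>P\<close>. Both conclusions rest on the same \<open>s\<close>.\<close>

lemma
  fixes M :: "('t, 'g, 'm) semimodule_structure" and N :: "('t, 'g, 'n) semimodule_structure"
    and P :: "('t, 'g, 'p) semimodule_structure"
  assumes M: "ternary_gamma_semimodule \<Gamma> T M" and N: "ternary_gamma_semimodule \<Gamma> T N"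
    and f: "f \<in> smod_hom \<Gamma> T M L" and g: "g \<in> smod_hom \<Gamma> T N L"
    and pb_fibre: "is_smod_pullback TYPE('m \<times> 'n) \<Gamma> T P p1 p2 M N L f g"
    and pb_self: "is_smod_pullback TYPE('p) \<Gamma> T P p1 p2 M N L f g"
  shows smod_pullback_inj: "inj_on (\<lambda>z. (p1 z, p2 z)) (carrier P)"
    and smod_pullback_image: "(\<lambda>z. (p1 z, p2 z)) ` carrier P = fibre_rel M N f g"
proof -
  let ?K = "fibre_prod M N f g" and ?p = "\<lambda>z. (p1 z, p2 z)"
  have K: "ternary_gamma_semimodule \<Gamma> T ?K"
    by (rule ternary_gamma_semimodule_fibre_prod[OF M N f g])
  have "\<forall>z \<in> carrier ?K. f (fst z) = g (snd z)"
    by (auto simp: fibre_rel_def)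
  then obtain s where s: "s \<in> smod_hom \<Gamma> T ?K P"
    and sect: "\<forall>z \<in> carrier ?K. p1 (s z) = fst z \<and> p2 (s z) = snd z"
    by (rule smod_pullback_universal[OF pb_fibre K smod_hom_fst_fibre_prod smod_hom_snd_fibre_prod])
  have p: "?p \<in> smod_hom \<Gamma> T P ?K"
    using is_smod_pullbackD[OF pb_self] by (blast intro: smod_hom_pair_fibre_prod)
  have pK: "?p z \<in> carrier ?K" if "z \<in> carrier P" for z
    using smod_hom_closed[OF p that] .
  \<comment> \<open>Joint monicity is applied to two endomorphisms of \<open>P\<close>, whose
    composites with the projections agree by \<open>sect\<close>.\<close>
  have "(s \<circ> ?p) z = id z" if z: "z \<in> carrier P" for z
  proof (rule smod_pullback_unique[OF pb_self smod_pullback_semimodule[OF pb_self]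
        smod_hom_comp[OF p s] smod_hom_id _ _ z])
    show "p1 ((s \<circ> ?p) w) = p1 (id w)" "p2 ((s \<circ> ?p) w) = p2 (id w)" if "w \<in> carrier P" for w
      using sect[THEN bspec, OF pK[OF that]] by simp_all
  qed
  then have "\<And>z. z \<in> carrier P \<Longrightarrow> s (?p z) = z" by simp
  then show "inj_on ?p (carrier P)"
    by (rule inj_on_inverseI)
  show "?p ` carrier P = fibre_rel M N f g"
  proof
    show "?p ` carrier P \<subseteq> fibre_rel M N f g"
      using pK by auto
    show "fibre_rel M N f g \<subseteq> ?p ` carrier P"
    proof
      fix z assume "z \<in> fibre_rel M N f g"
      then have z: "z \<in> carrier ?K" by simp
      \<comment> \<open>The section itself supplies the preimage of \<open>z\<close>.\<close>
      have "z = ?p (s z)"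
        using sect[THEN bspec, OF z] by (simp add: prod_eq_iff)
      then show "z \<in> ?p ` carrier P"
        using smod_hom_closed[OF s z] by (rule image_eqI)
    qed
  qed
qed

text \<open>Equality of values is an equivalence, and it is stable under sums and the action because
  \<open>f\<close> preserves both and \<open>M\<close> is closed under them.\<close>

lemma smod_congruence_kernel_rel:
  assumes "ternary_gamma_semimodule \<Gamma> T M" and f: "f \<in> smod_hom \<Gamma> T M N"
  shows "smod_congruence \<Gamma> T M (kernel_rel M f)"
proof -
  interpret M: ternary_gamma_semimodule \<Gamma> T M by fact
  have "equiv (carrier M) (kernel_rel M f)"
    by (rule equivI) (auto simp: kernel_rel_def intro!: refl_onI symI transI)
  then show ?thesis
    by (auto simp: smod_congruence_def kernel_rel_def smod_homD[OF f] M.act_closed)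
qed

text \<open>As \<open>'q\<close> is arbitrary, the first conjunct gives universality in the full
  category. The second tests \<open>P\<close> only at the types \<open>'m \<times> 'm\<close> and
  \<open>'p\<close>, so it covers every kernel pair in the full category with elements in
  \<open>'p\<close>; the injective morphism to the product exhibits \<open>P\<close> as a
  subobject.\<close>

theorem lemma8p2:
  fixes \<Gamma> :: "'g monoid"
    and T :: "('t, 'g) ternary_structure"
    and M :: "('t, 'g, 'm) semimodule_structure"
    and N :: "('t, 'g, 'n) semimodule_structure"
    and f :: "'m \<Rightarrow> 'n"
  assumes "ternary_gamma_semiring \<Gamma> T"
    and "ternary_gamma_semimodule \<Gamma> T M"
    and "ternary_gamma_semimodule \<Gamma> T N"
    and "f \<in> smod_hom \<Gamma> T M N"
  shows "is_kernel_pair TYPE('q) \<Gamma> T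
           ((smod_prod M M)\<lparr>carrier := kernel_rel M f\<rparr>) fst snd M N f \<and>
         (\<forall>(P :: ('t, 'g, 'p) semimodule_structure) p1 p2.
           is_kernel_pair TYPE('m \<times> 'm) \<Gamma> T P p1 p2 M N f \<and>
           is_kernel_pair TYPE('p) \<Gamma> T P p1 p2 M N f \<longrightarrow>
           (\<lambda>z. (p1 z, p2 z)) \<in> smod_hom \<Gamma> T P (smod_prod M M) \<and>
           inj_on (\<lambda>z. (p1 z, p2 z)) (carrier P) \<and>
           underlying_rel P p1 p2 = kernel_rel M f) \<and>
         smod_congruence \<Gamma> T M (kernel_rel M f)"
proof (intro conjI allI impI)
  show "is_kernel_pair TYPE('q) \<Gamma> T
      ((smod_prod M M)\<lparr>carrier := kernel_rel M f\<rparr>) fst snd M N f"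
    unfolding is_kernel_pair_def kernel_rel_eq_fibre_rel
    by (rule is_smod_pullback_fibre_prod) fact+
  show "smod_congruence \<Gamma> T M (kernel_rel M f)"
    by (rule smod_congruence_kernel_rel) fact+
next
  fix P :: "('t, 'g, 'p) semimodule_structure" and p1 p2
  assume "is_kernel_pair TYPE('m \<times> 'm) \<Gamma> T P p1 p2 M N f \<and>
    is_kernel_pair TYPE('p) \<Gamma> T P p1 p2 M N f"
  then have pb: "is_smod_pullback TYPE('m \<times> 'm) \<Gamma> T P p1 p2 M M N f f"
      "is_smod_pullback TYPE('p) \<Gamma> T P p1 p2 M M N f f"
    by (simp_all add: is_kernel_pair_def)
  show "(\<lambda>z. (p1 z, p2 z)) \<in> smod_hom \<Gamma> T P (smod_prod M M)"
    using smod_pullback_hom_1[OF pb(2)] smod_pullback_hom_2[OF pb(2)] by (rule smod_hom_pair)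
  show "inj_on (\<lambda>z. (p1 z, p2 z)) (carrier P)"
    \<comment> \<open>Both legs of the cospan are \<open>f\<close>, so the facts on \<open>M\<close>
      and on \<open>f\<close> are each supplied twice.\<close>
    using assms(2,2,4,4) pb by (rule smod_pullback_inj)
  show "underlying_rel P p1 p2 = kernel_rel M f"
    unfolding underlying_rel_def kernel_rel_eq_fibre_rel
    using assms(2,2,4,4) pb by (rule smod_pullback_image)
qed

end
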